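(* Let $X$ be an arbitrary bounded metric space, let $\lambda>0$ be a real number, and let $\lambda\Delta$ be a simplex all of whose non-zero distances equal $\lambda$, of cardinality $m=\#\lambda\Delta\le\#X$. Suppose that $\alpha_m(X)=0$. Then $$2d_{GH}(\lambda\Delta,X)=\max\{d_m(X),\ \lambda,\ \operatorname{diam}X-\lambda\}.$$
   Context: Metric spaces are assumed non-empty. $\#X$ denotes the cardinality of $X$; $|xy|$ denotes the distance between points $x,y$. A simplex is a metric space all of whose non-zero distances are equal; $\lambda\Delta$ denotes a simplex whose non-zero distances all equal $\lambda>0$ (its cardinality may be any finite or infinite non-zero cardinal). For metric spaces $X,Y$, the Gromov--Hausdorff distance $d_{GH}(X,Y)$ is the infimum of real numbers $r$ for which there exist a metric space $Z$ and subsets $X',Y'\subset Z$ isometric to $X$ and $Y$, respectively, such that $d_H(X',Y')\le r$, where $d_H$ is the Hausdorff distance in $Z$. For a cardinal number $m\le\#X$ let $\mathcal{D}_m(X)$ be the set of all partitions of $X$ into $m$ non-empty subsets. For $D=\{X_i\}_{i\in I}\in\mathcal{D}_m(X)$ put $\operatorname{diam}D=\sup_{i\in I}\operatorname{diam}X_i$ and $\alpha(D)=\inf\{|X_iX_j| : i\ne j\}$, where $|AB|=\inf\{|ab| : a\in A,\ b\in B\}$ for non-empty $A,B\subset X$; for $m=1$ the infimum over the empty set is $\alpha(D)=+\infty$. Put $$\alpha_m(X)=\sup_{D\in\mathcal{D}_m(X)}\alpha(D),\qquad d_m(X)=\inf_{D\in\mathcal{D}_m(X)}\operatorname{diam}D.$$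 *)

theory Defs
  imports "HOL-Analysis.Analysis" "HOL-Library.Disjoint_Sets"
begin

text \<open>
  A metric space is a value of type \<^typ>\<open>'a metric\<close> (a carrier with a distance on it).
  This type admits the empty carrier, so non-emptiness is stated explicitly where needed.
  Suprema and infima are taken in \<^typ>\<open>ereal\<close>, so that they always exist and the infimum over
  the empty set is \<^term>\<open>\<infinity> :: ereal\<close>.
  Cardinal numbers are given as in the library, by relations up to \<^const>\<open>ordIso\<close>;
  the cardinality of a set \<open>A\<close> is \<^term>\<open>card_of A\<close>.
\<close>

subsection \<open>Gromov--Hausdorff distance\<close>

definition isometric :: "'a metric \<Rightarrow> 'b metric \<Rightarrow> bool" where
  "isometric X Y \<longleftrightarrow> (\<exists>f. bij_betw f (mspace X) (mspace Y) \<and>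
     (\<forall>x\<in>mspace X. \<forall>y\<in>mspace X. mdist Y (f x) (f y) = mdist X x y))"

definition hausdorff_dist :: "'a metric \<Rightarrow> 'a set \<Rightarrow> 'a set \<Rightarrow> ereal" where
  "hausdorff_dist Z A B =
     max (SUP a\<in>A. INF b\<in>B. ereal (mdist Z a b)) (SUP b\<in>B. INF a\<in>A. ereal (mdist Z a b))"

text \<open>
  The definition cannot quantify over the type underlying the ambient space \<open>Z\<close>. Only the points
  of \<open>A \<union> B\<close> matter, and this set embeds into the sum type, so \<open>'a + 'b\<close> is large enough; the
  lemma \<open>gh_dist_le\<close> below confirms that ambient spaces over other types give nothing new.
  The carrier of \<open>Z\<close> is an arbitrary subset of \<open>'a + 'b\<close>, and \<open>A\<close>, \<open>B\<close> may overlap.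
\<close>

definition gh_dist :: "'a metric \<Rightarrow> 'b metric \<Rightarrow> ereal" where
  "gh_dist X Y = Inf {ereal r | r. \<exists>(Z :: ('a + 'b) metric) A B.
     A \<subseteq> mspace Z \<and> B \<subseteq> mspace Z \<and>
     isometric X (submetric Z A) \<and> isometric Y (submetric Z B) \<and>
     hausdorff_dist Z A B \<le> ereal r}"

lemma gh_dist_le:
  fixes X :: "'a metric" and Y :: "'b metric" and Z :: "'c metric"
  assumes A: "A \<subseteq> mspace Z" and B: "B \<subseteq> mspace Z"
    and XA: "isometric X (submetric Z A)" and YB: "isometric Y (submetric Z B)"
    and r: "hausdorff_dist Z A B \<le> ereal r"
  shows "gh_dist X Y \<le> ereal r"
proof -
  obtain f where f: "bij_betw f (mspace X) A"
    "\<And>x y. x \<in> mspace X \<Longrightarrow> y \<in> mspace X \<Longrightarrow> mdist Z (f x) (f y) = mdist X x y"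
    using XA A by (auto simp: isometric_def Int_absorb2 Int_absorb1)
  obtain g where g: "bij_betw g (mspace Y) B"
    "\<And>x y. x \<in> mspace Y \<Longrightarrow> y \<in> mspace Y \<Longrightarrow> mdist Z (g x) (g y) = mdist Y x y"
    using YB B by (auto simp: isometric_def Int_absorb2 Int_absorb1)
  define h :: "'c \<Rightarrow> 'a + 'b" where
    "h c = (if c \<in> A then Inl (inv_into (mspace X) f c) else Inr (inv_into (mspace Y) g c))" for c
  have h: "inj_on h (A \<union> B)"
    using f(1) g(1) unfolding inj_on_def h_def bij_betw_def
    by (auto split: if_splits dest!: inv_into_injective)
  define k where "k = inv_into (A \<union> B) h"
  have k[simp]: "k (h c) = c" if "c \<in> A \<union> B" for c
    using h that by (simp add: k_def)
  have AB: "c \<in> A \<union> B \<Longrightarrow> c \<in> mspace Z" for c using A B by blast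
  define d where "d u v = mdist Z (k u) (k v)" for u v
  have M: "Metric_space (h ` (A \<union> B)) d"
  proof
    show "0 \<le> d u v" "d u v = d v u" for u v
      by (auto simp: d_def mdist_commute)
    show "d u v = 0 \<longleftrightarrow> u = v" if uv: "u \<in> h ` (A \<union> B)" "v \<in> h ` (A \<union> B)" for u v
    proof -
      obtain a b where ab: "a \<in> A \<union> B" "b \<in> A \<union> B" "u = h a" "v = h b"
        using uv by blast
      have "d u v = mdist Z a b" using ab by (simp add: d_def)
      then show ?thesis using ab AB h by (metis inj_on_def mdist_zero)
    qed
    show "d u w \<le> d u v + d v w"
      if uv: "u \<in> h ` (A \<union> B)" "v \<in> h ` (A \<union> B)" "w \<in> h ` (A \<union> B)" for u v w
    proof -
      obtain a b c where abc: "a \<in> A \<union> B" "b \<in> A \<union> B" "c \<in> A \<union> B" "u = h a" "v = h b" "w = h c"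
        using uv by blast
      then show ?thesis using AB by (simp only: d_def k) (blast intro: mdist_triangle)
    qed
  qed
  define Z' where "Z' = metric (h ` (A \<union> B), d)"
  have sp: "mspace Z' = h ` (A \<union> B)" and di: "mdist Z' = d"
    using M by (auto simp: Z'_def Metric_space.mspace_metric Metric_space.mdist_metric)
  have dh: "mdist Z' (h a) (h b) = mdist Z a b" if "a \<in> A \<union> B" "b \<in> A \<union> B" for a b
    using that by (simp add: di d_def)
  have sub: "h ` A \<subseteq> mspace Z'" "h ` B \<subseteq> mspace Z'" by (auto simp: sp)
  have fA: "f x \<in> A" if "x \<in> mspace X" for x
    using that f(1) by (auto simp: bij_betw_def)
  have gB: "g x \<in> B" if "x \<in> mspace Y" for x
    using that g(1) by (auto simp: bij_betw_def)
  have "bij_betw h A (h ` A)" "bij_betw h B (h ` B)"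
    using h by (auto simp: bij_betw_def intro: inj_on_subset)
  then have bij: "bij_betw (h \<circ> f) (mspace X) (h ` A)" "bij_betw (h \<circ> g) (mspace Y) (h ` B)"
    using f(1) g(1) bij_betw_trans by blast+
  have "isometric X (submetric Z' (h ` A))"
    unfolding isometric_def using bij(1) sub(1) fA f(2)
    by (intro exI[of _ "h \<circ> f"]) (auto simp: Int_absorb1 Int_absorb2 dh)
  moreover have "isometric Y (submetric Z' (h ` B))"
    unfolding isometric_def using bij(2) sub(2) gB g(2)
    by (intro exI[of _ "h \<circ> g"]) (auto simp: Int_absorb1 Int_absorb2 dh)
  moreover have "hausdorff_dist Z' (h ` A) (h ` B) = hausdorff_dist Z A B"
    unfolding hausdorff_dist_def image_image
    by (intro arg_cong2[where f = max] SUP_cong INF_cong refl) (simp_all add: dh)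
  ultimately show ?thesis
    unfolding gh_dist_def using sub r by (intro Inf_lower CollectI) metis
qed

subsection \<open>Simplices and partitions\<close>

definition is_simplex :: "real \<Rightarrow> 'a metric \<Rightarrow> bool" where
  "is_simplex l S \<longleftrightarrow> mspace S \<noteq> {} \<and>
     (\<forall>x\<in>mspace S. \<forall>y\<in>mspace S. mdist S x y \<noteq> 0 \<longrightarrow> mdist S x y = l)"

text \<open>The next two functions are only meant for non-empty sets of points.\<close>

definition mdiam :: "'a metric \<Rightarrow> 'a set \<Rightarrow> ereal" where
  "mdiam X A = (SUP x\<in>A. SUP y\<in>A. ereal (mdist X x y))"

definition mset_dist :: "'a metric \<Rightarrow> 'a set \<Rightarrow> 'a set \<Rightarrow> ereal" where
  "mset_dist X A B = (INF a\<in>A. INF b\<in>B. ereal (mdist X a b))"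

definition partitions_card :: "'c rel \<Rightarrow> 'a metric \<Rightarrow> 'a set set set" where
  "partitions_card m X = {D. partition_on (mspace X) D \<and> (card_of D, m) \<in> ordIso}"

definition partition_diam :: "'a metric \<Rightarrow> 'a set set \<Rightarrow> ereal" where
  "partition_diam X D = (SUP A\<in>D. mdiam X A)"

definition partition_alpha :: "'a metric \<Rightarrow> 'a set set \<Rightarrow> ereal" where
  "partition_alpha X D = Inf {mset_dist X A B | A B. A \<in> D \<and> B \<in> D \<and> A \<noteq> B}"

definition alpha_card :: "'c rel \<Rightarrow> 'a metric \<Rightarrow> ereal" where
  "alpha_card m X = (SUP D\<in>partitions_card m X. partition_alpha X D)"

definition d_card :: "'c rel \<Rightarrow> 'a metric \<Rightarrow> ereal" where
  "d_card m X = (INF D\<in>partitions_card m X. partition_diam X D)"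

end

theory Submission
  imports Defs
begin

text \<open>
  Twice the Gromov--Hausdorff distance is the infimum of the distortions of correspondences
  between the two spaces, and everything below is phrased with correspondences
  \<open>R \<subseteq> S \<times> X\<close> of distortion at most \<open>e\<close>.  Write \<open>m\<close> for the cardinality of the simplex \<open>S\<close>.

  Upper bound.  A partition \<open>D\<close> of \<open>X\<close> into \<open>m\<close> parts gives a correspondence: match the parts
  bijectively with the points of \<open>S\<close>, and relate a point of \<open>S\<close> to all points of its part.
  Two points of one part contribute at most \<open>diam D\<close> to the distortion, and points \<open>x\<close>, \<open>y\<close> of
  different parts contribute \<open>\<bar>l - |xy|\<bar> \<le> max l (diam X - l)\<close>
  (lemma \<open>gh_dist_simplex_le_partition\<close>).

  Lower bound.  Let \<open>R\<close> be a correspondence of distortion at most \<open>e\<close>; three bounds on \<open>e\<close> are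
  needed.  All distances in \<open>S\<close> are at most \<open>l\<close>, so \<open>diam X \<le> l + e\<close>.  If \<open>e < l\<close>, then points of
  \<open>X\<close> related to different points of \<open>S\<close> are at least \<open>l - e > 0\<close> apart; hence \<open>R\<close> is the graph of a
  surjection \<open>X \<rightarrow> S\<close>, and its fibres form a partition with positive \<open>\<alpha>\<close>, which \<open>\<alpha>\<^sub>m(X) = 0\<close> excludes
  (lemma \<open>simplex_edge_le_of_correspondence\<close>).  Finally \<open>d\<^sub>m(X) \<le> e\<close>: choose any map \<open>f : X \<rightarrow> S\<close>
  inside \<open>R\<close>; its fibres have diameter at most \<open>e\<close>, but some of them can be empty.  Since
  \<open>m \<le> #X\<close>, the partition by the non-empty fibres can be refined to one with exactly \<open>m\<close>
  parts, and refining does not increase diameters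
  (lemmas \<open>surjection_refining_map\<close> and \<open>d_card_le_of_correspondence\<close>).
\<close>

section \<open>Correspondences and the Gromov--Hausdorff distance\<close>

lemma mdist_self [simp]: "x \<in> mspace X \<Longrightarrow> mdist X x x = 0"
  by simp

definition correspondence_within :: "real \<Rightarrow> 'a metric \<Rightarrow> 'b metric \<Rightarrow> ('a \<times> 'b) set \<Rightarrow> bool" where
  "correspondence_within e X Y R \<longleftrightarrow> Domain R = mspace X \<and> Range R = mspace Y \<and>
     (\<forall>(x, y)\<in>R. \<forall>(x', y')\<in>R. \<bar>mdist X x x' - mdist Y y y'\<bar> \<le> e)"

lemma correspondence_withinD:
  assumes "correspondence_within e X Y R"
  shows "(x, y) \<in> R \<Longrightarrow> x \<in> mspace X" "(x, y) \<in> R \<Longrightarrow> y \<in> mspace Y"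
    and "x \<in> mspace X \<Longrightarrow> \<exists>y. (x, y) \<in> R" "y \<in> mspace Y \<Longrightarrow> \<exists>x. (x, y) \<in> R"
    and "(x, y) \<in> R \<Longrightarrow> (x', y') \<in> R \<Longrightarrow> \<bar>mdist X x x' - mdist Y y y'\<bar> \<le> e"
proof -
  have "Domain R = mspace X" "Range R = mspace Y"
    and d: "\<forall>(x, y)\<in>R. \<forall>(x', y')\<in>R. \<bar>mdist X x x' - mdist Y y y'\<bar> \<le> e"
    using assms by (auto simp: correspondence_within_def)
  then show "(x, y) \<in> R \<Longrightarrow> x \<in> mspace X" "(x, y) \<in> R \<Longrightarrow> y \<in> mspace Y"
    "x \<in> mspace X \<Longrightarrow> \<exists>y. (x, y) \<in> R" "y \<in> mspace Y \<Longrightarrow> \<exists>x. (x, y) \<in> R"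
    by blast+
  show "(x, y) \<in> R \<Longrightarrow> (x', y') \<in> R \<Longrightarrow> \<bar>mdist X x x' - mdist Y y y'\<bar> \<le> e"
    using d by blast
qed

text \<open>
  The spaces are glued along \<open>R\<close>: on the disjoint union, the distance from \<open>x\<close> to \<open>y\<close> is the
  infimum of the lengths of the paths that cross from \<open>X\<close> to \<open>Y\<close> once, along a pair of \<open>R\<close>, where
  each crossing has length \<open>c\<close>.  A path that crosses twice, and so returns to the space it left, is not
  a shortcut, because the distortion of \<open>R\<close> is at most the length \<open>2 * c\<close> of two crossings.
\<close>

lemma gh_dist_le_of_correspondence:
  fixes X :: "'a metric" and Y :: "'b metric"
  assumes R: "correspondence_within (2 * c) X Y R" and c: "c > 0" and ne: "mspace X \<noteq> {}"
  shows "gh_dist X Y \<le> ereal c"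
proof -
  note RD = correspondence_withinD[OF R]
  have Rne: "R \<noteq> {}" using ne RD(3) by fastforce
  define h where "h x y p = mdist X x (fst p) + mdist Y (snd p) y" for x y p
  define \<delta> where "\<delta> x y = c + (INF p\<in>R. h x y p)" for x y
  have bdd: "bdd_below (h x y ` R)" for x y
    by (rule bdd_belowI[of _ 0]) (auto simp: h_def)
  have \<delta>_le: "\<delta> x y \<le> c + mdist X x u + mdist Y v y" if "(u, v) \<in> R" for x y u v
    unfolding \<delta>_def using cINF_lower[OF bdd that, of x y] by (simp add: h_def)
  have \<delta>_approx: "\<exists>u v. (u, v) \<in> R \<and> c + mdist X x u + mdist Y v y < \<delta> x y + e" if "e > 0" for x y e
  proof -
    have "(INF p\<in>R. h x y p) < (INF p\<in>R. h x y p) + e" using that by simp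
    then obtain p where "p \<in> R" "h x y p < (INF p\<in>R. h x y p) + e"
      using cINF_less_iff[OF Rne bdd] by blast
    then show ?thesis
      by (intro exI[of _ "fst p"] exI[of _ "snd p"]) (simp add: h_def \<delta>_def)
  qed
  have \<delta>_ge: "c \<le> \<delta> x y" for x y
    unfolding \<delta>_def using cINF_greatest[OF Rne, of 0 "h x y"] by (simp add: h_def)
  have tri_X: "\<delta> x y \<le> mdist X x x' + \<delta> x' y"
    if "x \<in> mspace X" "x' \<in> mspace X" for x x' y
  proof (rule field_le_epsilon)
    fix e :: real assume "e > 0"
    then obtain u v where uv: "(u, v) \<in> R" "c + mdist X x' u + mdist Y v y < \<delta> x' y + e"
      using \<delta>_approx by blast
    have "mdist X x u \<le> mdist X x x' + mdist X x' u"
      using that RD(1)[OF uv(1)] by (intro mdist_triangle)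
    then show "\<delta> x y \<le> mdist X x x' + \<delta> x' y + e" using \<delta>_le[OF uv(1), of x y] uv(2) by linarith
  qed
  have tri_Y: "\<delta> x y \<le> \<delta> x y' + mdist Y y' y"
    if "y \<in> mspace Y" "y' \<in> mspace Y" for x y y'
  proof (rule field_le_epsilon)
    fix e :: real assume "e > 0"
    then obtain u v where uv: "(u, v) \<in> R" "c + mdist X x u + mdist Y v y' < \<delta> x y' + e"
      using \<delta>_approx by blast
    have "mdist Y v y \<le> mdist Y v y' + mdist Y y' y"
      using that RD(2)[OF uv(1)] by (intro mdist_triangle)
    then show "\<delta> x y \<le> \<delta> x y' + mdist Y y' y + e" using \<delta>_le[OF uv(1), of x y] uv(2) by linarith
  qed
  have tri_XYX: "mdist X x x' \<le> \<delta> x y + \<delta> x' y"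
    if "x \<in> mspace X" "x' \<in> mspace X" "y \<in> mspace Y" for x x' y
  proof (rule field_le_epsilon)
    fix e :: real assume "e > 0"
    then have e: "e / 2 > 0" by simp
    obtain u v where uv: "(u, v) \<in> R" "c + mdist X x u + mdist Y v y < \<delta> x y + e / 2"
      using \<delta>_approx[OF e] by blast
    obtain u' v' where uv': "(u', v') \<in> R" "c + mdist X x' u' + mdist Y v' y < \<delta> x' y + e / 2"
      using \<delta>_approx[OF e] by blast
    note m = that RD(1,2)[OF uv(1)] RD(1,2)[OF uv'(1)]
    have "mdist X x x' \<le> mdist X x u + mdist X u x'" "mdist X u x' \<le> mdist X u u' + mdist X x' u'"
      "mdist Y v v' \<le> mdist Y v y + mdist Y v' y"
      using m by (simp_all add: mdist_triangle mdist_commute[of X x' u'] mdist_commute[of Y v' y])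
    with RD(5)[OF uv(1) uv'(1)] uv(2) uv'(2)
    show "mdist X x x' \<le> \<delta> x y + \<delta> x' y + e" by linarith
  qed
  have tri_YXY: "mdist Y y y' \<le> \<delta> x y + \<delta> x y'"
    if "y \<in> mspace Y" "y' \<in> mspace Y" "x \<in> mspace X" for x y y'
  proof (rule field_le_epsilon)
    fix e :: real assume "e > 0"
    then have e: "e / 2 > 0" by simp
    obtain u v where uv: "(u, v) \<in> R" "c + mdist X x u + mdist Y v y < \<delta> x y + e / 2"
      using \<delta>_approx[OF e] by blast
    obtain u' v' where uv': "(u', v') \<in> R" "c + mdist X x u' + mdist Y v' y' < \<delta> x y' + e / 2"
      using \<delta>_approx[OF e] by blast
    note m = that RD(1,2)[OF uv(1)] RD(1,2)[OF uv'(1)]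
    have "mdist Y y y' \<le> mdist Y v y + mdist Y v y'" "mdist Y v y' \<le> mdist Y v v' + mdist Y v' y'"
      "mdist X u u' \<le> mdist X x u + mdist X x u'"
      using m by (simp_all add: mdist_triangle mdist_commute[of Y v y] mdist_commute[of X x u])
    with RD(5)[OF uv(1) uv'(1)] uv(2) uv'(2)
    show "mdist Y y y' \<le> \<delta> x y + \<delta> x y' + e" by linarith
  qed
  define d where "d p q = (case p of
      Inl x \<Rightarrow> (case q of Inl x' \<Rightarrow> mdist X x x' | Inr y \<Rightarrow> \<delta> x y)
    | Inr y \<Rightarrow> (case q of Inl x \<Rightarrow> \<delta> x y | Inr y' \<Rightarrow> mdist Y y y'))" for p q
  define A :: "('a + 'b) set" where "A = Inl ` mspace X"
  define B :: "('a + 'b) set" where "B = Inr ` mspace Y"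
  have \<delta>_pos: "0 < \<delta> x y" for x y using \<delta>_ge[of x y] c by linarith
  have M: "Metric_space (A \<union> B) d"
  proof
    show "0 \<le> d p q" for p q
      by (auto simp: d_def less_imp_le[OF \<delta>_pos] split: sum.split)
    show "d p q = d q p" for p q
      by (auto simp: d_def mdist_commute split: sum.split)
    show "d p q = 0 \<longleftrightarrow> p = q" if "p \<in> A \<union> B" "q \<in> A \<union> B" for p q
      using that \<delta>_pos by (auto simp: d_def A_def B_def less_le)
    show "d p r \<le> d p q + d q r" if "p \<in> A \<union> B" "q \<in> A \<union> B" "r \<in> A \<union> B" for p q r
    proof -
      have "\<delta> x y \<le> \<delta> x' y + mdist X x' x" if "x \<in> mspace X" "x' \<in> mspace X" for x x' y
        using tri_X[OF that, of y] by (simp add: mdist_commute)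
      moreover have "\<delta> x y \<le> mdist Y y y' + \<delta> x y'" if "y \<in> mspace Y" "y' \<in> mspace Y" for x y y'
        using tri_Y[OF that, of x] by (simp add: mdist_commute)
      ultimately show ?thesis
        using that tri_X tri_Y tri_XYX tri_YXY
        by (auto simp: d_def A_def B_def mdist_triangle)
    qed
  qed
  define Z where "Z = metric (A \<union> B, d)"
  have sp: "mspace Z = A \<union> B" and di: "mdist Z = d"
    using M by (auto simp: Z_def Metric_space.mspace_metric Metric_space.mdist_metric)
  have sub: "A \<subseteq> mspace Z" "B \<subseteq> mspace Z" by (auto simp: sp)
  have "isometric X (submetric Z A)"
    unfolding isometric_def using sub(1)
    by (intro exI[of _ Inl]) (auto simp: Int_absorb1 Int_absorb2 di d_def A_def bij_betw_def)
  moreover have "isometric Y (submetric Z B)"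
    unfolding isometric_def using sub(2)
    by (intro exI[of _ Inr]) (auto simp: Int_absorb1 Int_absorb2 di d_def B_def bij_betw_def)
  moreover have "hausdorff_dist Z A B \<le> ereal c"
  proof -
    have \<delta>R: "\<delta> x y \<le> c" if "(x, y) \<in> R" for x y
      using \<delta>_le[OF that, of x y] RD(1,2)[OF that] by simp
    have "(INF b\<in>B. ereal (mdist Z a b)) \<le> ereal c" if a: "a \<in> A" for a
    proof -
      obtain x where x: "x \<in> mspace X" "a = Inl x" using a by (auto simp: A_def)
      then obtain y where y: "(x, y) \<in> R" using RD(3) by blast
      then have "Inr y \<in> B" using RD(2) by (auto simp: B_def)
      moreover have "ereal (mdist Z a (Inr y)) \<le> ereal c"
        using \<delta>R[OF y] x by (simp add: di d_def)
      ultimately show ?thesis by (rule INF_lower2)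
    qed
    moreover have "(INF a\<in>A. ereal (mdist Z a b)) \<le> ereal c" if b: "b \<in> B" for b
    proof -
      obtain y where y: "y \<in> mspace Y" "b = Inr y" using b by (auto simp: B_def)
      then obtain x where x: "(x, y) \<in> R" using RD(4) by blast
      then have "Inl x \<in> A" using RD(1) by (auto simp: A_def)
      moreover have "ereal (mdist Z (Inl x) b) \<le> ereal c"
        using \<delta>R[OF x] y by (simp add: di d_def)
      ultimately show ?thesis by (rule INF_lower2)
    qed
    ultimately show ?thesis by (simp add: hausdorff_dist_def SUP_le_iff)
  qed
  ultimately show ?thesis by (rule gh_dist_le[OF sub])
qed

text \<open>
  In a common ambient space with Hausdorff distance below \<open>c\<close>, the pairs of points that are less than
  \<open>c\<close> apart form a correspondence.  The strict inequality is essential: at Hausdorff distance exactly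
  \<open>c\<close> the infimum of the distances need not be attained.
\<close>

lemma correspondence_of_gh_dist_less:
  assumes "gh_dist X Y < ereal c"
  obtains R where "correspondence_within (2 * c) X Y R"
proof -
  obtain r and Z :: "('a + 'b) metric" and A B where rc: "r < c"
    and A: "A \<subseteq> mspace Z" and B: "B \<subseteq> mspace Z"
    and XA: "isometric X (submetric Z A)" and YB: "isometric Y (submetric Z B)"
    and H: "hausdorff_dist Z A B \<le> ereal r"
    using assms unfolding gh_dist_def Inf_less_iff by auto
  obtain f where f: "f ` mspace X = A"
    "\<And>x y. x \<in> mspace X \<Longrightarrow> y \<in> mspace X \<Longrightarrow> mdist Z (f x) (f y) = mdist X x y"
    using XA A by (auto simp: isometric_def Int_absorb2 Int_absorb1 bij_betw_def)
  obtain g where g: "g ` mspace Y = B"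
    "\<And>x y. x \<in> mspace Y \<Longrightarrow> y \<in> mspace Y \<Longrightarrow> mdist Z (g x) (g y) = mdist Y x y"
    using YB B by (auto simp: isometric_def Int_absorb2 Int_absorb1 bij_betw_def)
  have HA: "(INF b\<in>B. ereal (mdist Z a b)) < ereal c" if "a \<in> A" for a
    using H that rc by (auto simp: hausdorff_dist_def SUP_le_iff intro: le_less_trans)
  have HB: "(INF a\<in>A. ereal (mdist Z a b)) < ereal c" if "b \<in> B" for b
    using H that rc by (auto simp: hausdorff_dist_def SUP_le_iff intro: le_less_trans)
  define R where "R = {(x, y). x \<in> mspace X \<and> y \<in> mspace Y \<and> mdist Z (f x) (g y) < c}"
  have total: "\<exists>y. (x, y) \<in> R" if "x \<in> mspace X" for x
    using HA[of "f x"] f(1) g(1) that by (auto simp: R_def INF_less_iff)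
  have onto: "\<exists>x. (x, y) \<in> R" if "y \<in> mspace Y" for y
    using HB[of "g y"] f(1) g(1) that by (auto simp: R_def INF_less_iff)
  have "\<bar>mdist X x x' - mdist Y y y'\<bar> \<le> 2 * c" if "(x, y) \<in> R" "(x', y') \<in> R" for x y x' y'
  proof -
    have m: "f x \<in> mspace Z" "f x' \<in> mspace Z" "g y \<in> mspace Z" "g y' \<in> mspace Z"
      using that A B f(1) g(1) by (auto simp: R_def)
    have "mdist Z (f x) (f x') \<le> mdist Z (f x) (g y) + mdist Z (g y) (f x')"
      "mdist Z (g y) (f x') \<le> mdist Z (g y) (g y') + mdist Z (g y') (f x')"
      "mdist Z (g y) (g y') \<le> mdist Z (g y) (f x) + mdist Z (f x) (g y')"
      "mdist Z (f x) (g y') \<le> mdist Z (f x) (f x') + mdist Z (f x') (g y')"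
      by (rule mdist_triangle; fact m)+
    moreover have "mdist Z (g y') (f x') = mdist Z (f x') (g y')"
      "mdist Z (g y) (f x) = mdist Z (f x) (g y)" by (rule mdist_commute)+
    moreover have "mdist Z (f x) (f x') = mdist X x x'" "mdist Z (g y) (g y') = mdist Y y y'"
      "mdist Z (f x) (g y) < c" "mdist Z (f x') (g y') < c"
      using that f(2) g(2) by (simp_all add: R_def)
    ultimately show ?thesis by linarith
  qed
  then have "\<forall>(x, y)\<in>R. \<forall>(x', y')\<in>R. \<bar>mdist X x x' - mdist Y y y'\<bar> \<le> 2 * c"
    by blast
  moreover have "Domain R = mspace X" using total by (auto simp: R_def)
  moreover have "Range R = mspace Y" using onto by (auto simp: R_def)
  ultimately have "correspondence_within (2 * c) X Y R"
    by (simp add: correspondence_within_def)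
  then show thesis by (rule that)
qed

section \<open>Refining a partition to a prescribed cardinality\<close>

text \<open>
  Take a copy \<open>C'\<close> of \<open>S\<close> inside \<open>C\<close>.  For infinite \<open>S\<close> the set \<open>A \<union> C'\<close> has the cardinality of \<open>S\<close>
  by absorption; for finite \<open>S\<close> it can be too large, and \<open>A\<close> is enlarged inside it.
\<close>

lemma subset_between_of_card:
  assumes "A \<subseteq> C" and "(card_of A, card_of S) \<in> ordLeq" and "(card_of S, card_of C) \<in> ordLeq"
  obtains T where "A \<subseteq> T" "T \<subseteq> C" "(card_of T, card_of S) \<in> ordIso"
proof -
  obtain i where i: "inj_on i S" "i ` S \<subseteq> C" using assms(3) unfolding card_of_ordLeq[symmetric] by auto
  define C' where "C' = i ` S"
  have "bij_betw i S C'" using i by (simp add: C'_def bij_betw_def)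
  then have C'S: "(card_of C', card_of S) \<in> ordIso"
    by (rule ordIso_symmetric[OF card_of_ordIsoI])
  have C': "C' \<subseteq> C" using i by (simp add: C'_def)
  show thesis
  proof (cases "finite S")
    case True
    have fin: "finite A" "finite C'" using True card_of_ordLeq_finite[OF assms(2)] by (simp_all add: C'_def)
    obtain j where "inj_on j A" "j ` A \<subseteq> S"
      using assms(2) unfolding card_of_ordLeq[symmetric] by auto
    then have "card A \<le> card S" using True by (rule card_inj_on_le)
    moreover have "card S \<le> card (A \<union> C')"
      using fin i card_image[OF i(1)] card_mono[of "A \<union> C'" C'] by (simp add: C'_def)
    ultimately obtain T where T: "A \<subseteq> T" "T \<subseteq> A \<union> C'" "card T = card S"
      using exists_subset_between[of A "card S" "A \<union> C'"] fin by blast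
    then have "finite T" using fin finite_subset by blast
    then have "(card_of T, card_of S) \<in> ordIso"
      using T(3) True finite_same_card_bij[of T S] card_of_ordIso[of T S] by simp
    then show thesis using that[of T] T(1,2) C' assms(1) by auto
  next
    case False
    have "(card_of (A \<union> C'), card_of S) \<in> ordLeq"
      using False assms(2) C'S
      by (intro card_of_Un_ordLeq_infinite_Field)
        (simp_all add: ordIso_iff_ordLeq Field_card_of card_of_card_order_on)
    moreover have "(card_of S, card_of (A \<union> C')) \<in> ordLeq"
      by (rule ordIso_ordLeq_trans[OF ordIso_symmetric[OF C'S] card_of_mono1]) simp
    ultimately show thesis using that[of "A \<union> C'"] C' assms(1) by (simp add: ordIso_iff_ordLeq)
  qed
qed

text \<open>
  A transversal of the fibres of \<open>f\<close> is enlarged to a set \<open>T \<subseteq> M\<close> of the cardinality of \<open>S\<close>.  Retract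
  \<open>M\<close> onto \<open>T\<close> by sending each point outside \<open>T\<close> to the representative of its fibre: the retraction
  stays inside the fibres of \<open>f\<close>, and its image \<open>T\<close> has the cardinality that \<open>f ` M\<close> can lack.
\<close>

lemma surjection_refining_map:
  assumes "(card_of S, card_of M) \<in> ordLeq" and "f ` M \<subseteq> S"
  obtains g where "g ` M = S" "\<And>x y. x \<in> M \<Longrightarrow> y \<in> M \<Longrightarrow> g x = g y \<Longrightarrow> f x = f y"
proof -
  define rep where "rep x = inv_into M f (f x)" for x
  have rep: "rep x \<in> M" "f (rep x) = f x" if "x \<in> M" for x
    using that by (auto simp: rep_def inv_into_into f_inv_into_f)
  have "rep ` M = inv_into M f ` (f ` M)" by (auto simp: rep_def)
  then have "(card_of (rep ` M), card_of S) \<in> ordLeq"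
    using ordLeq_transitive[OF card_of_image card_of_mono1[OF assms(2)]] by simp
  moreover have "rep ` M \<subseteq> M" using rep by blast
  ultimately obtain T where T: "rep ` M \<subseteq> T" "T \<subseteq> M" "(card_of T, card_of S) \<in> ordIso"
    using subset_between_of_card[OF _ _ assms(1)] by metis
  then obtain b where b: "bij_betw b T S" unfolding card_of_ordIso[symmetric] by auto
  define u where "u x = (if x \<in> T then x else rep x)" for x
  have u: "u x \<in> T" "f (u x) = f x" if "x \<in> M" for x
    using that T rep by (auto simp: u_def)
  have "u ` M = T" using T u(1) by (force simp: u_def)
  then have "(b \<circ> u) ` M = S" using b by (simp add: bij_betw_def flip: image_image)
  moreover have "f x = f y" if "x \<in> M" "y \<in> M" "(b \<circ> u) x = (b \<circ> u) y" for x y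
  proof -
    have "u x = u y" using that u(1) b by (auto simp: bij_betw_def inj_on_def)
    then show ?thesis using u(2) that by metis
  qed
  ultimately show thesis by (rule that)
qed

lemma fibres_in_partitions_card:
  assumes "g ` mspace X = S"
  shows "(\<lambda>s. {x \<in> mspace X. g x = s}) ` S \<in> partitions_card (card_of S) X"
proof -
  let ?F = "\<lambda>s. {x \<in> mspace X. g x = s}"
  have "partition_on (mspace X) (?F ` S)"
    using assms by (auto simp: partition_on_def disjoint_def)
  moreover have "inj_on ?F S" using assms by (fastforce simp: inj_on_def)
  then have "(card_of (?F ` S), card_of S) \<in> ordIso"
    by (rule ordIso_symmetric[OF card_of_ordIsoI[OF inj_on_imp_bij_betw]])
  ultimately show ?thesis by (simp add: partitions_card_def)
qed

section \<open>Lower bound for the distance to a simplex\<close>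

lemma mdiam_le_iff: "mdiam X A \<le> ereal c \<longleftrightarrow> (\<forall>x\<in>A. \<forall>y\<in>A. mdist X x y \<le> c)"
  by (simp add: mdiam_def SUP_le_iff)

lemma partition_diam_le_iff:
  "partition_diam X D \<le> ereal c \<longleftrightarrow> (\<forall>A\<in>D. \<forall>x\<in>A. \<forall>y\<in>A. mdist X x y \<le> c)"
  by (simp add: partition_diam_def SUP_le_iff mdiam_le_iff)

lemma simplex_dist:
  assumes "is_simplex l S" "s \<in> mspace S" "t \<in> mspace S"
  shows "mdist S s t = (if s = t then 0 else l)"
  using assms by (auto simp: is_simplex_def)

text \<open>
  A map \<open>f\<close> with \<open>(f x, x) \<in> R\<close> has fibres of diameter at most \<open>e\<close>, but it can miss points of \<open>S\<close>;
  so its fibres are refined to exactly as many parts as \<open>S\<close> has points.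
\<close>

lemma d_card_le_of_correspondence:
  assumes R: "correspondence_within e S X R"
    and le: "(card_of (mspace S), card_of (mspace X)) \<in> ordLeq"
  shows "d_card (card_of (mspace S)) X \<le> ereal e"
proof -
  note RD = correspondence_withinD[OF R]
  obtain f where f: "\<And>x. x \<in> mspace X \<Longrightarrow> (f x, x) \<in> R" using RD(4) by metis
  then have "f ` mspace X \<subseteq> mspace S" using RD(1) by blast
  then obtain g where g: "g ` mspace X = mspace S"
    "\<And>x y. x \<in> mspace X \<Longrightarrow> y \<in> mspace X \<Longrightarrow> g x = g y \<Longrightarrow> f x = f y"
    using surjection_refining_map[OF le] by metis
  let ?D = "(\<lambda>s. {x \<in> mspace X. g x = s}) ` mspace S"
  have "mdist X x y \<le> e" if "x \<in> mspace X" "y \<in> mspace X" "g x = g y" for x y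
  proof -
    have "f x = f y" using g(2) that by blast
    then show ?thesis using RD(5)[OF f f, of x y] that RD(1)[OF f[of y]] by simp
  qed
  then have "partition_diam X ?D \<le> ereal e"
    unfolding partition_diam_le_iff by auto
  then show ?thesis
    unfolding d_card_def using fibres_in_partitions_card[OF g(1)] by (rule INF_lower2[rotated])
qed

text \<open>
  A distortion below the edge length separates the points related to different vertices, so the
  correspondence would be a partition of \<open>X\<close> with parts a positive distance apart.  When \<open>S\<close> is a single
  point this separation is vacuous and the \<open>\<alpha>\<close> of that partition is \<open>\<infinity>\<close>, a contradiction as well.
\<close>

lemma simplex_edge_le_of_correspondence:
  assumes R: "correspondence_within e S X R" and simp: "is_simplex l S"
    and alpha: "alpha_card (card_of (mspace S)) X \<le> 0"
  shows "l \<le> e"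
proof (rule ccontr)
  assume "\<not> l \<le> e"
  then have e: "e < l" by simp
  note RD = correspondence_withinD[OF R]
  have sep: "l - e \<le> mdist X x y" if "(s, x) \<in> R" "(t, y) \<in> R" "s \<noteq> t" for s t x y
    using RD(5)[OF that(1,2)] RD(1) that by (simp add: simplex_dist[OF simp])
  obtain f where f: "\<And>x. x \<in> mspace X \<Longrightarrow> (f x, x) \<in> R" using RD(4) by metis
  \<comment> \<open>Separation with \<open>x = y\<close> shows that no point of \<open>X\<close> is related to two vertices.\<close>
  have R_f: "s = f x" if "(s, x) \<in> R" for s x
    using sep[OF that f[of x]] RD(2)[OF that] e by (cases "s = f x") auto
  have "f ` mspace X = mspace S"
    using RD(1) RD(2) RD(3) R_f f by blast
  then have "(\<lambda>s. {x \<in> mspace X. f x = s}) ` mspace S \<in> partitions_card (card_of (mspace S)) X"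
    (is "?D \<in> _") by (rule fibres_in_partitions_card)
  then have "partition_alpha X ?D \<le> 0"
    using alpha by (auto simp: alpha_card_def SUP_le_iff)
  moreover have "ereal (l - e) \<le> partition_alpha X ?D"
    unfolding partition_alpha_def mset_dist_def
    by (rule Inf_greatest) (auto intro!: INF_greatest sep f)
  ultimately have "ereal (l - e) \<le> 0" by order
  then show False using e by simp
qed

lemma mdiam_le_of_correspondence:
  assumes R: "correspondence_within e S X R" and simp: "is_simplex l S" and l: "l > 0"
  shows "mdiam X (mspace X) \<le> ereal (l + e)"
  unfolding mdiam_le_iff
proof (intro ballI)
  note RD = correspondence_withinD[OF R]
  fix x y assume "x \<in> mspace X" "y \<in> mspace X"
  then obtain s t where st: "(s, x) \<in> R" "(t, y) \<in> R" using RD(4) by blast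
  have "mdist S s t \<le> l" using st RD(1) l by (simp add: simplex_dist[OF simp])
  then show "mdist X x y \<le> l + e" using RD(5)[OF st] by linarith
qed

text \<open>
  The infimum in the Gromov--Hausdorff distance need not be attained by a correspondence, so the
  inequality is tested against the reals \<open>e\<close> strictly above \<open>2 * gh_dist S X\<close>.
\<close>

lemma gh_dist_simplex_ge:
  fixes X :: "'a metric" and S :: "'b metric"
  assumes simp: "is_simplex l S" and l: "l > 0"
    and le: "(card_of (mspace S), card_of (mspace X)) \<in> ordLeq"
    and alpha: "alpha_card (card_of (mspace S)) X \<le> 0"
  shows "max (d_card (card_of (mspace S)) X) (max (ereal l) (mdiam X (mspace X) - ereal l))
    \<le> 2 * gh_dist S X" (is "?K \<le> _")
proof (rule ccontr)
  assume "\<not> ?K \<le> 2 * gh_dist S X"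
  then obtain e where e: "2 * gh_dist S X < ereal e" "ereal e < ?K"
    using ereal_dense2[of "2 * gh_dist S X" ?K] by (auto simp only: not_le)
  have "gh_dist S X < ereal (e / 2)" using e(1) by (cases "gh_dist S X") auto
  then obtain R where "correspondence_within (2 * (e / 2)) S X R"
    by (rule correspondence_of_gh_dist_less)
  then have R: "correspondence_within e S X R" by simp
  have "mdiam X (mspace X) - ereal l \<le> ereal e"
    using mdiam_le_of_correspondence[OF R simp l] by (cases "mdiam X (mspace X)") auto
  then have "?K \<le> ereal e"
    using d_card_le_of_correspondence[OF R le] simplex_edge_le_of_correspondence[OF R simp alpha]
    by (simp only: max.bounded_iff ereal_less_eq simp_thms)
  then show False using e(2) by order
qed

section \<open>Upper bound from a partition, and the formula\<close>

text \<open>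
  The parts of \<open>D\<close> are matched with the vertices.  Inside a part the distortion is at most its
  diameter; across parts \<open>|xy|\<close> lies between \<open>0\<close> and \<open>diam X \<le> l + e\<close>, so it differs from \<open>l\<close> by at
  most \<open>e\<close> because \<open>l \<le> e\<close>.
\<close>

lemma gh_dist_simplex_le_partition:
  fixes X :: "'a metric" and S :: "'b metric"
  assumes simp: "is_simplex l S" and l: "l > 0"
    and D: "D \<in> partitions_card (card_of (mspace S)) X"
    and diamD: "partition_diam X D \<le> ereal e" and le: "l \<le> e"
    and diam: "mdiam X (mspace X) \<le> ereal (l + e)"
  shows "gh_dist S X \<le> ereal (e / 2)"
proof -
  have P: "partition_on (mspace X) D" and "(card_of D, card_of (mspace S)) \<in> ordIso"
    using D by (auto simp: partitions_card_def)
  then obtain h where h: "bij_betw h D (mspace S)" unfolding card_of_ordIso[symmetric] by auto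
  define R where "R = {(h A, x) | A x. A \<in> D \<and> x \<in> A}"
  have ne: "A \<noteq> {}" and sub: "A \<subseteq> mspace X" if "A \<in> D" for A
    using P that by (auto simp: partition_on_def)
  have "\<bar>mdist S (h A) (h B) - mdist X x y\<bar> \<le> e"
    if "A \<in> D" "B \<in> D" "x \<in> A" "y \<in> B" for A B x y
  proof (cases "A = B")
    case True
    have "mdist X x y \<le> e" using diamD that True by (auto simp: partition_diam_le_iff)
    moreover have "h A \<in> mspace S" using h that(1) by (auto simp: bij_betw_def)
    ultimately show ?thesis using True by simp
  next
    case False
    then have "h A \<noteq> h B" "h A \<in> mspace S" "h B \<in> mspace S"
      using that(1,2) h by (auto simp: bij_betw_def dest: inj_onD)
    then have "mdist S (h A) (h B) = l" by (simp add: simplex_dist[OF simp])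
    moreover have "mdist X x y \<le> l + e" using diam sub that by (force simp: mdiam_le_iff)
    ultimately show ?thesis using le mdist_nonneg[of X x y] unfolding abs_le_iff by linarith
  qed
  then have "\<forall>(s, x)\<in>R. \<forall>(t, y)\<in>R. \<bar>mdist S s t - mdist X x y\<bar> \<le> e"
    by (auto simp: R_def)
  moreover have "Domain R = mspace S"
  proof -
    have "Domain R = h ` D" using ne by (fastforce simp: R_def)
    then show ?thesis using h by (simp add: bij_betw_def)
  qed
  moreover have "Range R = mspace X"
  proof -
    have "Range R = \<Union> D" by (auto simp: R_def)
    then show ?thesis using P by (simp add: partition_on_def)
  qed
  ultimately have "correspondence_within (2 * (e / 2)) S X R"
    by (simp add: correspondence_within_def)
  then show ?thesis
    by (rule gh_dist_le_of_correspondence) (use l le simp in \<open>auto simp: is_simplex_def\<close>)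
qed

theorem theorem2p12:
  fixes X :: "'a metric" and S :: "'b metric" and l :: real
  assumes "mspace X \<noteq> {}"
    and "Metric_space.mbounded (mspace X) (mdist X) (mspace X)"
    and "l > 0"
    and "is_simplex l S"
    and "(card_of (mspace S), card_of (mspace X)) \<in> ordLeq"
    and "alpha_card (card_of (mspace S)) X = 0"
  shows "2 * gh_dist S X =
    max (d_card (card_of (mspace S)) X) (max (ereal l) (mdiam X (mspace X) - ereal l))"
proof (rule antisym)
  let ?m = "card_of (mspace S)"
  obtain b where b: "\<And>x y. x \<in> mspace X \<Longrightarrow> y \<in> mspace X \<Longrightarrow> mdist X x y \<le> b"
    using assms(2) Metric_space.mbounded_alt[OF Metric_space_mspace_mdist] by metis
  have diam_b: "mdiam X (mspace X) \<le> ereal b" using b by (simp add: mdiam_le_iff)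
  obtain x where "x \<in> mspace X" using assms(1) by blast
  then have "ereal 0 \<le> mdiam X (mspace X)"
    unfolding mdiam_def by (intro SUP_upper2[of x]) auto
  with diam_b obtain \<Delta> where \<Delta>: "mdiam X (mspace X) = ereal \<Delta>"
    by (cases "mdiam X (mspace X)") auto
  \<comment> \<open>Boundedness makes all terms finite, so that the real-valued bound \<open>e\<close> of
      \<open>gh_dist_simplex_le_partition\<close> can be chosen as the maximum itself.\<close>
  have *: "2 * gh_dist S X \<le> max (partition_diam X D) (ereal (max l (\<Delta> - l)))"
    if D: "D \<in> partitions_card ?m X" for D
  proof -
    have "partition_diam X D \<le> ereal b"
      using D b by (fastforce simp: partition_diam_le_iff partitions_card_def partition_on_def)
    then obtain e where e: "max (partition_diam X D) (ereal (max l (\<Delta> - l))) = ereal e"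
      using that[of "max (real_of_ereal (partition_diam X D)) (max l (\<Delta> - l))"]
      by (cases "partition_diam X D") (auto simp del: ereal_max simp: ereal_max[symmetric])
    then have "partition_diam X D \<le> ereal e" "ereal (max l (\<Delta> - l)) \<le> ereal e"
      using max.cobounded1 max.cobounded2 by metis+
    then have "gh_dist S X \<le> ereal (e / 2)"
      using D \<Delta> by (intro gh_dist_simplex_le_partition[OF assms(4,3)]) auto
    then show ?thesis unfolding e by (cases "gh_dist S X") auto
  qed
  have "2 * gh_dist S X \<le> max (d_card ?m X) (ereal (max l (\<Delta> - l)))"
  proof (cases "2 * gh_dist S X \<le> ereal (max l (\<Delta> - l))")
    case False
    then have "2 * gh_dist S X \<le> partition_diam X D" if "D \<in> partitions_card ?m X" for D
      using *[OF that] unfolding le_max_iff_disj by blast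
    then have "2 * gh_dist S X \<le> d_card ?m X" unfolding d_card_def by (rule INF_greatest)
    then show ?thesis by (simp add: le_max_iff_disj)
  qed (simp add: le_max_iff_disj)
  moreover have "ereal (max l (\<Delta> - l)) = max (ereal l) (mdiam X (mspace X) - ereal l)"
    by (simp add: \<Delta>)
  ultimately show "2 * gh_dist S X \<le> max (d_card ?m X) (max (ereal l) (mdiam X (mspace X) - ereal l))"
    by (simp only:)
next
  show "max (d_card (card_of (mspace S)) X) (max (ereal l) (mdiam X (mspace X) - ereal l))
    \<le> 2 * gh_dist S X"
    using assms by (intro gh_dist_simplex_ge) auto
qed

end
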